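(* Suppose the empirical Jacobian conditioning assumption (parts (i), (ii), (iii) in the context) holds. Then the empirical $Q$-objective $\widehat R_Q(\theta):=\widehat L_{\rm NLL}(\theta)+\widehat L_{\rm BE}(\theta)$ satisfies a Polyak–Łojasiewicz inequality on $B_Q$: there exists $c_{\widehat R}>0$ such that $$\tfrac12\|\nabla_\theta\widehat R_Q(\theta)\|_2^2\ge c_{\widehat R}\bigl(\widehat R_Q(\theta)-\widehat R_Q^*\bigr)\qquad\forall\theta\in B_Q,$$ where $\widehat R_Q^*=\inf_{\theta\in B_Q}\widehat R_Q(\theta)$. Moreover, for each fixed $\theta_2\in B_Q$, the auxiliary loss $\widehat F_\zeta(\cdot;\theta_2)$ satisfies a Polyak–Łojasiewicz inequality on $B_\zeta$: there is $c_\zeta>0$ with $\tfrac12\|\nabla_\phi\widehat F_\zeta(\phi;\theta_2)\|_2^2\ge c_\zeta(\widehat F_\zeta(\phi;\theta_2)-\widehat F^*_\zeta(\theta_2))$ for all $\phi\in B_\zeta$, where $\widehat F_\zeta^*(\theta_2)=\inf_{\phi\in B_\zeta}\widehat F_\zeta(\phi;\theta_2)$.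
   Context: $\mathcal S$ is a (possibly continuous) state space, $\mathcal A$ a finite action set, $\beta\in(0,1)$, $r$ a reward, and $s\mapsto a_s\in\mathcal A$ a given anchor action map. $Q_\theta:\mathcal S\times\mathcal A\to\mathbb R$ ($\theta\in\mathbb R^{d_\theta}$) and $\zeta_\phi:\mathcal S\times\mathcal A\to\mathbb R$ ($\phi\in\mathbb R^{d_\phi}$) are parametrized functions. $V_Q(s)=\log\sum_{b\in\mathcal A}\exp Q(s,b)$, $\hat p_Q(a\mid s)=\exp(Q(s,a))/\sum_b\exp(Q(s,b))$. Grouped empirical losses (from a finite dataset). NLL: $\mathcal X_{\rm NLL}\subset\mathcal S$ is a finite set of distinct sampled states, with empirical weights $\omega^{\rm NLL}_x>0$, $\sum_x\omega^{\rm NLL}_x=1$, and empirical action distributions $\widehat\pi_x$ on $\mathcal A$; $\widehat L_{\rm NLL}(\theta)=\sum_{x\in\mathcal X_{\rm NLL}}\omega_x^{\rm NLL}\sum_{a\in\mathcal A}\widehat\pi_x(a)[-\log\hat p_{Q_\theta}(a\mid x)]$. Bellman error: $\mathcal X_{\rm BE}=\{x_1,\dots,x_B\}$ are the distinct sampled current states at which the anchor action is taken, with weights $\omega_j^{\rm BE}>0$, $\sum_j\omega_j^{\rm BE}=1$, finitely supported empirical next-state probability distributions $\widehat P_j$ on $\mathcal S$, and empirical mean rewards $\widehat r_j$; $\Psi_j(\theta)=\widehat r_j+\beta\sum_y\widehat P_j(y)V_{Q_\theta}(y)-Q_\theta(x_j,a_{x_j})$ and $\widehat L_{\rm BE}(\theta)=\sum_{j=1}^B\omega_j^{\rm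 BE}\Psi_j(\theta)^2$. Auxiliary regression: $Z_\zeta=\{\bar z_1,\dots,\bar z_G\}\subset\mathcal S\times\mathcal A$ are distinct sampled state-action pairs with weights $\omega_g^\zeta>0$, $\sum_g\omega^\zeta_g=1$; $\bar y_g(\theta_2)$ is the average of $V_{Q_{\theta_2}}(\bar s')$ over the sampled next states $\bar s'$ observed after $\bar z_g$; $\widehat F_\zeta(\phi;\theta_2)=\beta^2\sum_{g=1}^G\omega_g^\zeta(\zeta_\phi(\bar z_g)-\bar y_g(\theta_2))^2$. Evaluation sets and Jacobians. $\mathcal X_Q=\mathcal X_{\rm NLL}\cup\mathcal X_{\rm BE}\cup\bigcup_j\operatorname{supp}\widehat P_j$, $Z_Q=\mathcal X_Q\times\mathcal A=\{z_1,\dots,z_M\}$, $J_Q(\theta;Z_Q)=D_\theta(Q_\theta(z_1),\dots,Q_\theta(z_M))^\top\in\mathbb R^{M\times d_\theta}$, $J_\zeta(\phi;Z_\zeta)=D_\phi(\zeta_\phi(\bar z_1),\dots,\zeta_\phi(\bar z_G))^\top$. Empirical Jacobian conditioning assumption. $B_Q=B(\theta_0,R_Q)$ and $B_\zeta=B(\phi_0,R_\zeta)$ are closed finite-radius balls containing the initial point, the optimization iterates and the empirical minimizers, and: (i) for every $z\in Z_Q$, $\theta\mapsto Q_\theta(z)$ is $C^2$ on $B_Q$ with $\sup_{\theta\in B_Q,z\in Z_Q}\|\nabla_\theta Q_\theta(z)\|_2<\infty$ and $\sup_{\theta\in B_Q,z\in Z_Q}\|\nabla^2_\theta Q_\theta(z)\|_{\rm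 op}<\infty$; likewise for $\phi\mapsto\zeta_\phi(\bar z)$, $\bar z\in Z_\zeta$, on $B_\zeta$; (ii) there is $\mu_Q>0$ with $J_Q(\theta;Z_Q)J_Q(\theta;Z_Q)^\top\succeq\mu_QI_M$ for all $\theta\in B_Q$; (iii) there is $\mu_\zeta>0$ with $J_\zeta(\phi;Z_\zeta)J_\zeta(\phi;Z_\zeta)^\top\succeq\mu_\zeta I_G$ for all $\phi\in B_\zeta$. *)

theory Defs
  imports "HOL-Analysis.Analysis" "HOL-Probability.Probability_Mass_Function"
begin

subsection \<open>Derivatives, smoothness, Loewner order\<close>

definition gradient :: "('v::real_inner \<Rightarrow> real) \<Rightarrow> 'v \<Rightarrow> 'v" where
  "gradient f x = (THE D. GDERIV f x :> D)"

lemma gradient_eqI: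
  assumes "GDERIV f x :> D"
  shows "gradient f x = D"
  unfolding gradient_def
proof (rule the_equality)
  fix E assume "GDERIV f x :> E"
  with assms have "(\<lambda>h. h \<bullet> E) = (\<lambda>h. h \<bullet> D)"
    unfolding gderiv_def by (rule has_derivative_unique[rotated])
  then have "(E - D) \<bullet> E = (E - D) \<bullet> D" by metis
  then have "(E - D) \<bullet> (E - D) = 0" by (simp add: inner_diff_right)
  then show "E = D" by simp
qed (rule assms)

definition hessian :: "(real ^ 'n \<Rightarrow> real) \<Rightarrow> real ^ 'n \<Rightarrow> real ^ 'n ^ 'n" where
  "hessian f x = jacobian (gradient f) (at x)"

text \<open>On a set that need not be open, \<open>C\<^sup>2\<close> means \<open>C\<^sup>2\<close> on some open neighbourhood of it, so that
  gradient and Hessian are ordinary two-sided derivatives also at boundary points.\<close>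

definition C2_on :: "(real ^ 'n) set \<Rightarrow> (real ^ 'n \<Rightarrow> real) \<Rightarrow> bool" where
  "C2_on B f \<longleftrightarrow> (\<exists>U. open U \<and> B \<subseteq> U \<and>
     (\<forall>x\<in>U. f differentiable (at x)) \<and>
     (\<forall>x\<in>U. gradient f differentiable (at x)) \<and>
     continuous_on U (hessian f))"

definition C2_bounded_family :: "(real ^ 'n) set \<Rightarrow> 'z set \<Rightarrow> (real ^ 'n \<Rightarrow> 'z \<Rightarrow> real) \<Rightarrow> bool" where
  "C2_bounded_family B Z f \<longleftrightarrow>
     (\<forall>z\<in>Z. C2_on B (\<lambda>x. f x z)) \<and>
     bdd_above {norm (gradient (\<lambda>x. f x z) x) | x z. x \<in> B \<and> z \<in> Z} \<and>
     bdd_above {onorm ((*v) (hessian (\<lambda>x. f x z) x)) | x z. x \<in> B \<and> z \<in> Z}"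

definition loewner_ge :: "real ^ 'n ^ 'n \<Rightarrow> real ^ 'n ^ 'n \<Rightarrow> bool" (infix "\<succeq>\<^sub>L" 50) where
  "A \<succeq>\<^sub>L C \<longleftrightarrow> transpose (A - C) = A - C \<and> (\<forall>v. 0 \<le> v \<bullet> ((A - C) *v v))"

text \<open>The rows of the Jacobian are indexed by a finite type \<open>'m\<close> through an enumeration \<open>z\<close> of the
  evaluation points.\<close>

definition eval_jacobian ::
    "(real ^ 'n \<Rightarrow> 'z \<Rightarrow> real) \<Rightarrow> ('m::finite \<Rightarrow> 'z) \<Rightarrow> real ^ 'n \<Rightarrow> real ^ 'n ^ 'm" where
  "eval_jacobian f z x = jacobian (\<lambda>x'. \<chi> i. f x' (z i)) (at x)"

definition jacobian_conditioned ::
    "(real ^ 'n) set \<Rightarrow> ('m::finite \<Rightarrow> 'z) \<Rightarrow> (real ^ 'n \<Rightarrow> 'z \<Rightarrow> real) \<Rightarrow> bool" where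
  "jacobian_conditioned B z f \<longleftrightarrow>
     (\<exists>\<mu>>0. \<forall>x\<in>B. eval_jacobian f z x ** transpose (eval_jacobian f z x) \<succeq>\<^sub>L mat \<mu>)"

definition PL_inequality_on :: "'v::real_inner set \<Rightarrow> ('v \<Rightarrow> real) \<Rightarrow> real \<Rightarrow> bool" where
  "PL_inequality_on B f c \<longleftrightarrow>
     (\<forall>x\<in>B. 1 / 2 * (norm (gradient f x))\<^sup>2 \<ge> c * (f x - (INF y\<in>B. f y)))"

definition minimizers :: "('v \<Rightarrow> real) \<Rightarrow> 'v set" where
  "minimizers f = {x. is_arg_min f (\<lambda>_. True) x}"

subsection \<open>Soft values, policies and empirical losses\<close>

definition soft_value :: "('s \<times> 'a::finite \<Rightarrow> real) \<Rightarrow> 's \<Rightarrow> real" where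
  "soft_value q s = ln (\<Sum>b\<in>UNIV. exp (q (s, b)))"

definition policy :: "('s \<times> 'a::finite \<Rightarrow> real) \<Rightarrow> 'a \<Rightarrow> 's \<Rightarrow> real" where
  "policy q a s = exp (q (s, a)) / (\<Sum>b\<in>UNIV. exp (q (s, b)))"

definition nll_loss ::
    "('p \<Rightarrow> 's \<times> 'a::finite \<Rightarrow> real) \<Rightarrow> 's set \<Rightarrow> ('s \<Rightarrow> real) \<Rightarrow> ('s \<Rightarrow> 'a pmf) \<Rightarrow> 'p \<Rightarrow> real" where
  "nll_loss Q X w \<pi> \<theta> =
     (\<Sum>x\<in>X. w x * (\<Sum>a\<in>UNIV. pmf (\<pi> x) a * (- ln (policy (Q \<theta>) a x))))"

definition bellman_residual ::
    "real \<Rightarrow> ('s \<Rightarrow> 'a::finite) \<Rightarrow> ('p \<Rightarrow> 's \<times> 'a \<Rightarrow> real) \<Rightarrow> ('b \<Rightarrow> 's) \<Rightarrow> ('b \<Rightarrow> 's pmf) \<Rightarrow> ('b \<Rightarrow> real)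
      \<Rightarrow> 'b \<Rightarrow> 'p \<Rightarrow> real" where
  "bellman_residual \<beta> anchor Q x P r j \<theta> =
     r j + \<beta> * (\<Sum>y\<in>set_pmf (P j). pmf (P j) y * soft_value (Q \<theta>) y) - Q \<theta> (x j, anchor (x j))"

definition be_loss ::
    "real \<Rightarrow> ('s \<Rightarrow> 'a::finite) \<Rightarrow> ('p \<Rightarrow> 's \<times> 'a \<Rightarrow> real) \<Rightarrow> ('b::finite \<Rightarrow> 's) \<Rightarrow> ('b \<Rightarrow> real)
      \<Rightarrow> ('b \<Rightarrow> 's pmf) \<Rightarrow> ('b \<Rightarrow> real) \<Rightarrow> 'p \<Rightarrow> real" where
  "be_loss \<beta> anchor Q x w P r \<theta> =
     (\<Sum>j\<in>UNIV. w j * (bellman_residual \<beta> anchor Q x P r j \<theta>)\<^sup>2)"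

text \<open>\<open>N\<close> is the multiset of sampled next states (with repetitions) observed after one
  state-action pair.\<close>

definition regression_target ::
    "('p \<Rightarrow> 's \<times> 'a::finite \<Rightarrow> real) \<Rightarrow> 's multiset \<Rightarrow> 'p \<Rightarrow> real" where
  "regression_target Q N \<theta> = (\<Sum>s'\<in>#N. soft_value (Q \<theta>) s') / real (size N)"

definition aux_loss ::
    "real \<Rightarrow> ('p \<Rightarrow> 's \<times> 'a::finite \<Rightarrow> real) \<Rightarrow> ('q \<Rightarrow> 's \<times> 'a \<Rightarrow> real) \<Rightarrow> ('g::finite \<Rightarrow> 's \<times> 'a)
      \<Rightarrow> ('g \<Rightarrow> real) \<Rightarrow> ('g \<Rightarrow> 's multiset) \<Rightarrow> 'p \<Rightarrow> 'q \<Rightarrow> real" where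
  "aux_loss \<beta> Q \<zeta> z w N \<theta>\<^sub>2 \<phi> =
     \<beta>\<^sup>2 * (\<Sum>g\<in>UNIV. w g * (\<zeta> \<phi> (z g) - regression_target Q (N g) \<theta>\<^sub>2)\<^sup>2)"

definition eval_pairs :: "'s set \<Rightarrow> ('b \<Rightarrow> 's) \<Rightarrow> ('b \<Rightarrow> 's pmf) \<Rightarrow> ('s \<times> 'a) set" where
  "eval_pairs X x P = (X \<union> range x \<union> (\<Union>j. set_pmf (P j))) \<times> UNIV"

end

theory Submission
  imports Defs
begin

text \<open>Write the gradient of the \<open>Q\<close>-objective as \<open>\<Sum>\<^bsub>s,a\<^esub> c(s,a) \<nabla>Q(s,a)\<close>; by conditioning its
  squared norm is at least \<open>\<mu> \<Sum> c\<^sup>2\<close>, so it suffices to bound the objective gap by \<open>\<Sum> c\<^sup>2\<close>.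
  The Bellman error is not convex in the values of \<open>Q\<close>, but summing \<open>c(s,a)\<close> over \<open>a\<close> cancels the
  likelihood part and leaves \<open>2 (\<beta> P\<^sup>T - I) m\<close> with \<open>m\<^sub>j = w\<^sub>j \<Psi>\<^sub>j\<close>. As \<open>\<beta> P\<^sup>T\<close> is an \<open>\<ell>\<^sub>1\<close> contraction,
  \<open>m\<close> is bounded by \<open>c\<close>, hence so are the Bellman error and then the likelihood part
  \<open>w(s) (p(a|s) - \<pi>\<^sub>s(a))\<close> of \<open>c\<close>. The latter controls the likelihood gap because the
  Kullback--Leibler divergence is at most the chi-square divergence, with \<open>p\<close> bounded below on the
  compact ball. Both losses are thus compared with global lower bounds (the entropy and \<open>0\<close>), which
  are at most the infimum over the ball.\<close>

section \<open>Gradients and their calculus\<close>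

lemma differentiable_gderiv_gradient:
  fixes f :: "real ^ 'n \<Rightarrow> real"
  assumes "f differentiable (at x)"
  shows "GDERIV f x :> gradient f x"
proof -
  obtain f' where f': "(f has_derivative f') (at x)"
    using assms by (auto simp: differentiable_def)
  \<comment> \<open>Riesz representation: a linear functional is the inner product with its adjoint
    evaluated at 1. This supplies the existence half that the definite description
    \<open>gradient\<close> requires.\<close>
  have "f' = (\<lambda>h. h \<bullet> adjoint f' 1)"
    using adjoint_works[OF has_derivative_linear[OF f']] by fastforce
  with f' have "GDERIV f x :> adjoint f' 1"
    by (simp add: gderiv_def)
  then show ?thesis
    using gradient_eqI by metis
qed

lemma C2_on_gderiv:
  assumes "C2_on B f" "x \<in> B"
  shows "GDERIV f x :> gradient f x"
  using assms by (auto simp: C2_on_def intro!: differentiable_gderiv_gradient)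

lemma gderiv_sum:
  assumes "\<And>i. i \<in> I \<Longrightarrow> GDERIV (f i) x :> D i"
  shows "GDERIV (\<lambda>y. \<Sum>i\<in>I. f i y) x :> (\<Sum>i\<in>I. D i)"
  using has_derivative_sum[of I f "\<lambda>i h. h \<bullet> D i" "at x"] assms
  by (simp add: gderiv_def inner_sum_right)

lemma gderiv_cmult:
  assumes "GDERIV f x :> D"
  shows "GDERIV (\<lambda>y. c * f y) x :> c *\<^sub>R D"
  using has_derivative_mult_right[of f "\<lambda>h. h \<bullet> D" "at x" c] assms
  by (simp add: gderiv_def)

lemma gderiv_power2:
  assumes "GDERIV f x :> D"
  shows "GDERIV (\<lambda>y. (f y)\<^sup>2) x :> (2 * f x) *\<^sub>R D"
  using has_derivative_power[of f "\<lambda>h. h \<bullet> D" x UNIV 2] assms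
  by (simp add: gderiv_def mult_ac)

section \<open>Jacobian conditioning as a lower bound on combinations of gradients\<close>

lemma eval_jacobian_nth:
  assumes "\<And>i. GDERIV (\<lambda>y. f y (z i)) x :> g i"
  shows "eval_jacobian f z x = (\<chi> i. g i)"
proof -
  have "((\<lambda>y. \<chi> i. f y (z i)) has_derivative (\<lambda>h. \<chi> i. h \<bullet> g i)) (at x)"
    using assms by (subst has_derivative_componentwise_within)
      (auto simp: gderiv_def Basis_vec_def inner_axis)
  then have "frechet_derivative (\<lambda>y. \<chi> i. f y (z i)) (at x) = (\<lambda>h. \<chi> i. h \<bullet> g i)"
    using frechet_derivative_at by metis
  then show ?thesis
    by (simp add: eval_jacobian_def jacobian_def matrix_def vec_eq_iff inner_axis')
qed

text \<open>Testing the Loewner bound on the coefficient vector \<open>c\<close> gives c^T J J^T c,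
  which is the squared norm of J^T c. Since the rows of J are the gradients \<open>g x i\<close>,
  the vector J^T c is exactly their combination with coefficients \<open>c i\<close>.\<close>

lemma jacobian_conditionedE:
  assumes "jacobian_conditioned B z f"
    and g: "\<And>x i. x \<in> B \<Longrightarrow> GDERIV (\<lambda>y. f y (z i)) x :> g x i"
  obtains \<mu> where "\<mu> > 0"
    "\<And>x c. x \<in> B \<Longrightarrow> \<mu> * (\<Sum>i\<in>UNIV. (c i)\<^sup>2) \<le> (norm (\<Sum>i\<in>UNIV. c i *\<^sub>R g x i))\<^sup>2"
proof -
  from assms(1) obtain \<mu> where \<mu>: "\<mu> > 0" and
    L: "\<And>x. x \<in> B \<Longrightarrow> eval_jacobian f z x ** transpose (eval_jacobian f z x) \<succeq>\<^sub>L mat \<mu>"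
    unfolding jacobian_conditioned_def by blast
  have "\<mu> * (\<Sum>i\<in>UNIV. (c i)\<^sup>2) \<le> (norm (\<Sum>i\<in>UNIV. c i *\<^sub>R g x i))\<^sup>2" if "x \<in> B" for x c
  proof -
    let ?J = "eval_jacobian f z x" and ?v = "\<chi> i. c i"
    have J: "?J = (\<chi> i. g x i)"
      by (rule eval_jacobian_nth) (rule g[OF that])
    have Jv: "transpose ?J *v ?v = (\<Sum>i\<in>UNIV. c i *\<^sub>R g x i)"
      by (simp add: J matrix_vector_mult_def transpose_def vec_eq_iff mult.commute)
    have mv: "mat \<mu> *v ?v = \<mu> *\<^sub>R ?v"
      by (simp add: matrix_vector_mult_def mat_def vec_eq_iff if_distribR
          if_distrib[of "\<lambda>t. t * _"] cong: if_cong)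
    have "0 \<le> ?v \<bullet> ((?J ** transpose ?J - mat \<mu>) *v ?v)"
      using L[OF that] by (auto simp: loewner_ge_def)
    also have "\<dots> = ?v \<bullet> (?J *v (transpose ?J *v ?v)) - \<mu> * (?v \<bullet> ?v)"
      by (simp add: matrix_vector_mult_diff_rdistrib inner_diff_right mv matrix_vector_mul_assoc
          del: transpose_matrix_vector)
    also have "?v \<bullet> (?J *v (transpose ?J *v ?v)) = (norm (transpose ?J *v ?v))\<^sup>2"
      by (metis dot_lmul_matrix power2_norm_eq_inner vector_transpose_matrix transpose_transpose)
    also have "?v \<bullet> ?v = (\<Sum>i\<in>UNIV. (c i)\<^sup>2)"
      by (simp add: inner_vec_def power2_eq_square)
    finally show ?thesis unfolding Jv by linarith
  qed
  with \<mu> show thesis by (rule that)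
qed

section \<open>Reference values and uniform positive lower bounds\<close>

text \<open>Lowering the reference value only enlarges the gap, so an explicit lower bound
  \<open>E\<close> can stand in for the infimum over the ball. It will be 0 for the regression loss
  and an entropy for the Q-objective.\<close>

lemma PL_inequality_onI:
  assumes "\<And>x. x \<in> B \<Longrightarrow> E \<le> f x"
    and "\<And>x. x \<in> B \<Longrightarrow> c * (f x - E) \<le> 1 / 2 * (norm (gradient f x))\<^sup>2" and "c \<ge> 0"
  shows "PL_inequality_on B f c"
  unfolding PL_inequality_on_def
proof
  fix x assume x: "x \<in> B"
  then have "E \<le> (INF y\<in>B. f y)"
    by (intro cINF_greatest) (auto intro: assms(1))
  then have "c * (f x - (INF y\<in>B. f y)) \<le> c * (f x - E)"
    by (intro mult_left_mono) (auto simp: \<open>c \<ge> 0\<close>)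
  also note assms(2)[OF x]
  finally show "1 / 2 * (norm (gradient f x))\<^sup>2 \<ge> c * (f x - (INF y\<in>B. f y))" .
qed

lemma finite_family_positive_lower_bound:
  fixes f :: "'i \<Rightarrow> 'x \<Rightarrow> real"
  assumes "finite I" "\<And>i. i \<in> I \<Longrightarrow> \<exists>\<delta>>0. \<forall>x\<in>B. \<delta> \<le> f i x"
  obtains \<delta> where "\<delta> > 0" "\<And>i x. i \<in> I \<Longrightarrow> x \<in> B \<Longrightarrow> \<delta> \<le> f i x"
proof -
  obtain d where d: "\<And>i. i \<in> I \<Longrightarrow> d i > 0 \<and> (\<forall>x\<in>B. d i \<le> f i x)"
    using assms(2) by metis
  \<comment> \<open>Inserting 1 keeps the minimum meaningful and positive when the family is
    empty.\<close>
  let ?\<delta> = "Min (insert 1 (d ` I))"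
  have "?\<delta> > 0" using d assms(1) by auto
  moreover have "?\<delta> \<le> d i" if "i \<in> I" for i using that assms(1) by (auto intro!: Min_le)
  ultimately show thesis using d by (intro that[of ?\<delta>]) (auto intro: order_trans)
qed

lemma finite_positive_lower_bound:
  fixes w :: "'i \<Rightarrow> real"
  assumes "finite I" "\<And>i. i \<in> I \<Longrightarrow> 0 < w i"
  obtains \<delta> where "\<delta> > 0" "\<And>i. i \<in> I \<Longrightarrow> \<delta> \<le> w i"
  by (rule finite_family_positive_lower_bound[of I UNIV "\<lambda>i _::unit. w i"])
    (use assms in auto)

section \<open>Softmax policy and soft value\<close>

lemma sum_exp_pos: "(0::real) < (\<Sum>b\<in>(UNIV::'a::finite set). exp (f b))"
  by (rule sum_pos) auto

lemma policy_pos: "0 < policy q a s"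
  by (simp add: policy_def sum_exp_pos)

lemma sum_policy: "(\<Sum>a\<in>UNIV. policy q a s) = 1"
  using sum_exp_pos[of "\<lambda>b. q (s, b)"]
  by (simp add: policy_def sum_divide_distrib[symmetric])

lemma policy_le_1: "policy q a s \<le> 1"
  using member_le_sum[of a UNIV "\<lambda>a. policy q a s"] policy_pos[of q _ s]
  by (simp add: sum_policy less_imp_le)

lemma ln_policy: "ln (policy q a s) = q (s, a) - soft_value q s"
  using sum_exp_pos[of "\<lambda>b. q (s, b)"]
  by (simp add: policy_def soft_value_def ln_div)

lemma sum_pmf_UNIV: "(\<Sum>a\<in>UNIV. pmf (p :: 'a::finite pmf) a) = 1"
  by (rule sum_pmf_eq_1) auto

lemma gderiv_soft_value:
  assumes "\<And>b. GDERIV (\<lambda>y. q y (s, b)) x :> g b"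
  shows "GDERIV (\<lambda>y. soft_value (q y) s) x :> (\<Sum>b\<in>UNIV. policy (q x) b s *\<^sub>R g b)"
proof -
  let ?S = "\<Sum>b\<in>UNIV. exp (q x (s, b))"
  have "GDERIV (\<lambda>y. \<Sum>b\<in>UNIV. exp (q y (s, b))) x :> (\<Sum>b\<in>UNIV. exp (q x (s, b)) *\<^sub>R g b)"
    by (intro gderiv_sum GDERIV_DERIV_compose[OF assms] DERIV_exp)
  then have "GDERIV (\<lambda>y. ln (\<Sum>b\<in>UNIV. exp (q y (s, b)))) x :>
      (1 / ?S) *\<^sub>R (\<Sum>b\<in>UNIV. exp (q x (s, b)) *\<^sub>R g b)"
    by (rule GDERIV_DERIV_compose) (rule DERIV_ln_divide[OF sum_exp_pos])
  then show ?thesis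
    by (simp add: soft_value_def policy_def scaleR_sum_right)
qed

section \<open>Norm and divergence inequalities\<close>

lemma sum_power2_le_power2_sum:
  fixes f :: "'i \<Rightarrow> real"
  assumes "finite I" "\<And>i. i \<in> I \<Longrightarrow> 0 \<le> f i"
  shows "(\<Sum>i\<in>I. (f i)\<^sup>2) \<le> (\<Sum>i\<in>I. f i)\<^sup>2"
proof -
  have "(\<Sum>i\<in>I. (f i)\<^sup>2) \<le> (\<Sum>i\<in>I. f i * (\<Sum>j\<in>I. f j))"
    using assms by (intro sum_mono) (auto simp: power2_eq_square intro!: mult_left_mono member_le_sum)
  then show ?thesis by (simp add: sum_distrib_right power2_eq_square)
qed

text \<open>The tangent bound ln t <= t - 1 at t = \<pi>/p replaces each logarithm by a rational
  term. That term splits into \<pi> - p, which sums to 0 because both are probability vectors, and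
  the chi-square term.\<close>

lemma kl_le_chi_square:
  fixes p :: "'a::finite \<Rightarrow> real"
  assumes p: "\<And>a. 0 < p a" "(\<Sum>a\<in>UNIV. p a) = 1"
  shows "(\<Sum>a\<in>UNIV. pmf \<pi> a * (- ln (p a))) - (\<Sum>a\<in>UNIV. pmf \<pi> a * (- ln (pmf \<pi> a)))
    \<le> (\<Sum>a\<in>UNIV. (p a - pmf \<pi> a)\<^sup>2 / p a)"
proof -
  have "(\<Sum>a\<in>UNIV. pmf \<pi> a * (- ln (p a))) - (\<Sum>a\<in>UNIV. pmf \<pi> a * (- ln (pmf \<pi> a)))
      = (\<Sum>a\<in>UNIV. pmf \<pi> a * (ln (pmf \<pi> a) - ln (p a)))"
    by (simp add: sum_subtractf[symmetric] algebra_simps sum_negf)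
  also have "\<dots> \<le> (\<Sum>a\<in>UNIV. (pmf \<pi> a - p a) + (p a - pmf \<pi> a)\<^sup>2 / p a)"
  proof (rule sum_mono)
    fix a
    have "pmf \<pi> a * (ln (pmf \<pi> a) - ln (p a)) \<le> pmf \<pi> a * (pmf \<pi> a / p a - 1)"
    \<comment> \<open>Where \<pi> vanishes, the factor in front removes the logarithm of 0, so both
      sides are 0.\<close>
    proof (cases "pmf \<pi> a = 0")
      case False
      then have pos: "0 < pmf \<pi> a" using pmf_nonneg[of \<pi> a] by linarith
      then have "ln (pmf \<pi> a / p a) \<le> pmf \<pi> a / p a - 1"
        using p(1)[of a] by (intro ln_le_minus_one) auto
      then show ?thesis using pos p(1)[of a] by (intro mult_left_mono) (auto simp: ln_div)
    qed simp
    also have "\<dots> = (pmf \<pi> a - p a) + (p a - pmf \<pi> a)\<^sup>2 / p a"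
      using p(1)[of a] by (simp add: field_simps power2_eq_square)
    finally show "pmf \<pi> a * (ln (pmf \<pi> a) - ln (p a)) \<le> (pmf \<pi> a - p a) + (p a - pmf \<pi> a)\<^sup>2 / p a" .
  qed
  also have "\<dots> = (\<Sum>a\<in>UNIV. (p a - pmf \<pi> a)\<^sup>2 / p a)"
    by (simp add: sum.distrib sum_subtractf p(2) sum_pmf_UNIV)
  finally show ?thesis .
qed

text \<open>The same tangent bound at the reciprocal ratio t = p/\<pi>, used where \<pi> is
  positive. Where \<pi> vanishes the left term is 0 and p is positive. Consequently the entropy
  bounds the cross entropy from below for every policy at once.\<close>

lemma gibbs_inequality:
  fixes p :: "'a::finite \<Rightarrow> real"
  assumes p: "\<And>a. 0 < p a" "(\<Sum>a\<in>UNIV. p a) = 1"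
  shows "(\<Sum>a\<in>UNIV. pmf \<pi> a * (- ln (pmf \<pi> a))) \<le> (\<Sum>a\<in>UNIV. pmf \<pi> a * (- ln (p a)))"
proof -
  have "(\<Sum>a\<in>UNIV. pmf \<pi> a * (ln (p a) - ln (pmf \<pi> a))) \<le> (\<Sum>a\<in>UNIV. p a - pmf \<pi> a)"
  proof (rule sum_mono)
    fix a
    show "pmf \<pi> a * (ln (p a) - ln (pmf \<pi> a)) \<le> p a - pmf \<pi> a"
    proof (cases "pmf \<pi> a = 0")
      case True
      then show ?thesis using p(1)[of a] by simp
    next
      case False
      then have pos: "0 < pmf \<pi> a" using pmf_nonneg[of \<pi> a] by linarith
      then have "ln (p a / pmf \<pi> a) \<le> p a / pmf \<pi> a - 1"
        using p(1)[of a] by (intro ln_le_minus_one) auto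
      then have "pmf \<pi> a * (ln (p a) - ln (pmf \<pi> a)) \<le> pmf \<pi> a * (p a / pmf \<pi> a - 1)"
        using pos p(1)[of a] by (intro mult_left_mono) (auto simp: ln_div)
      also have "\<dots> = p a - pmf \<pi> a" using pos by (simp add: field_simps)
      finally show ?thesis .
    qed
  qed
  then show ?thesis
    by (simp add: sum_subtractf p(2) sum_pmf_UNIV algebra_simps sum_negf)
qed

section \<open>The auxiliary regression loss\<close>

text \<open>With \<theta>_2 fixed the targets are constants, so this is weighted least squares in
  the values of \<zeta>. The gradient coefficients are the residuals times 2 \<beta>^2 w, and the
  squares of these control the loss itself once the weights are bounded below.\<close>

lemma aux_loss_PL:
  fixes \<zeta> :: "real ^ 'e \<Rightarrow> 's \<times> 'a::finite \<Rightarrow> real" and z :: "'g::finite \<Rightarrow> 's \<times> 'a"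
  assumes \<beta>: "0 < \<beta>" and w: "\<And>g. 0 < w g"
    and C2: "\<And>g. C2_on B (\<lambda>\<phi>. \<zeta> \<phi> (z g))" and cond: "jacobian_conditioned B z \<zeta>"
  shows "\<exists>c>0. PL_inequality_on B (aux_loss \<beta> Q \<zeta> z w N \<theta>\<^sub>2) c"
proof -
  define g where "g \<phi> i = gradient (\<lambda>\<phi>. \<zeta> \<phi> (z i)) \<phi>" for \<phi> i
  define y where "y i = regression_target Q (N i) \<theta>\<^sub>2" for i
  have g: "GDERIV (\<lambda>\<phi>. \<zeta> \<phi> (z i)) \<phi> :> g \<phi> i" if "\<phi> \<in> B" for \<phi> i
    using C2_on_gderiv[OF C2 that] by (simp add: g_def)
  obtain \<mu> where \<mu>: "\<mu> > 0" and cond':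
    "\<And>\<phi> c. \<phi> \<in> B \<Longrightarrow> \<mu> * (\<Sum>i\<in>UNIV. (c i)\<^sup>2) \<le> (norm (\<Sum>i\<in>UNIV. c i *\<^sub>R g \<phi> i))\<^sup>2"
    by (rule jacobian_conditionedE[of B z \<zeta> g, OF cond g]) blast+
  obtain \<delta> where \<delta>: "\<delta> > 0" "\<And>i. \<delta> \<le> w i"
    by (rule finite_positive_lower_bound[of UNIV w]) (use w in auto)
  let ?F = "aux_loss \<beta> Q \<zeta> z w N \<theta>\<^sub>2"
  have F: "?F = (\<lambda>\<phi>. \<Sum>i\<in>UNIV. (\<beta>\<^sup>2 * w i) * (\<zeta> \<phi> (z i) - y i)\<^sup>2)"
    by (simp add: aux_loss_def fun_eq_iff y_def sum_distrib_left mult.assoc)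
  have grad: "gradient ?F \<phi> = (\<Sum>i\<in>UNIV. (2 * \<beta>\<^sup>2 * w i * (\<zeta> \<phi> (z i) - y i)) *\<^sub>R g \<phi> i)"
    if "\<phi> \<in> B" for \<phi>
  proof (rule gradient_eqI)
    have "GDERIV (\<lambda>\<phi>. \<zeta> \<phi> (z i) - y i) \<phi> :> g \<phi> i - 0" for i
      by (intro GDERIV_diff g[OF that] GDERIV_const)
    then have "GDERIV (\<lambda>\<phi>. \<Sum>i\<in>UNIV. (\<beta>\<^sup>2 * w i) * (\<zeta> \<phi> (z i) - y i)\<^sup>2) \<phi> :>
        (\<Sum>i\<in>UNIV. (\<beta>\<^sup>2 * w i) *\<^sub>R (2 * (\<zeta> \<phi> (z i) - y i)) *\<^sub>R (g \<phi> i - 0))"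
      by (intro gderiv_sum gderiv_cmult gderiv_power2)
    then show "GDERIV ?F \<phi> :> (\<Sum>i\<in>UNIV. (2 * \<beta>\<^sup>2 * w i * (\<zeta> \<phi> (z i) - y i)) *\<^sub>R g \<phi> i)"
      unfolding F by (simp add: algebra_simps)
  qed
  \<comment> \<open>The squared coefficients sum to at least 4 \<beta>^2 \<delta> times the loss.
    Conditioning contributes \<mu>, and the factor 1/2 in the inequality leaves 2 \<mu> \<beta>^2
    \<delta>.\<close>
  have "PL_inequality_on B ?F (2 * \<mu> * \<beta>\<^sup>2 * \<delta>)"
  proof (rule PL_inequality_onI[where E = 0])
    fix \<phi> assume \<phi>: "\<phi> \<in> B"
    show "0 \<le> ?F \<phi>" unfolding F by (intro sum_nonneg mult_nonneg_nonneg) (auto simp: less_imp_le[OF w])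
    have "(4 * \<beta>\<^sup>2 * \<delta>) * ?F \<phi> \<le> (\<Sum>i\<in>UNIV. (2 * \<beta>\<^sup>2 * w i * (\<zeta> \<phi> (z i) - y i))\<^sup>2)"
      unfolding F sum_distrib_left
    proof (rule sum_mono)
      fix i
      have "\<delta> * (4 * \<beta>\<^sup>2 * \<beta>\<^sup>2 * w i * (\<zeta> \<phi> (z i) - y i)\<^sup>2)
          \<le> w i * (4 * \<beta>\<^sup>2 * \<beta>\<^sup>2 * w i * (\<zeta> \<phi> (z i) - y i)\<^sup>2)"
        using \<delta>(2)[of i] w[of i] by (intro mult_right_mono) auto
      then show "4 * \<beta>\<^sup>2 * \<delta> * (\<beta>\<^sup>2 * w i * (\<zeta> \<phi> (z i) - y i)\<^sup>2)
          \<le> (2 * \<beta>\<^sup>2 * w i * (\<zeta> \<phi> (z i) - y i))\<^sup>2"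
        by (simp add: power_mult_distrib mult_ac power2_eq_square[of "w i"] power2_eq_square[of "\<beta>\<^sup>2"])
    qed
    then have "\<mu> * ((4 * \<beta>\<^sup>2 * \<delta>) * ?F \<phi>) \<le> (norm (gradient ?F \<phi>))\<^sup>2"
      using cond'[OF \<phi>] \<mu> unfolding grad[OF \<phi>] by (meson mult_left_mono order_trans less_imp_le)
    then show "2 * \<mu> * \<beta>\<^sup>2 * \<delta> * (?F \<phi> - 0) \<le> 1 / 2 * (norm (gradient ?F \<phi>))\<^sup>2"
      by simp
  qed (use \<mu> \<delta> in auto)
  then show ?thesis using \<mu> \<delta> \<beta> by (intro exI[of _ "2 * \<mu> * \<beta>\<^sup>2 * \<delta>"]) auto
qed

section \<open>The contraction that recovers the weighted Bellman residuals\<close>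

text \<open>The quantity bounded by \<open>D\<close> is the entry at \<open>s\<close> of \<beta> P^T
  m minus m, with \<open>m j\<close> placed at the state \<open>x j\<close>. At
  \<open>s = x k\<close> injectivity isolates \<open>m k\<close>, so the triangle inequality bounds
  its absolute value by the propagated mass plus \<open>D (x k)\<close>. Summing over
  \<open>k\<close> propagates at most \<beta> times the l1 norm of \<open>m\<close>, which is
  absorbed on the left.\<close>

lemma bellman_contraction:
  fixes m :: "'b::finite \<Rightarrow> real" and x :: "'b \<Rightarrow> 's" and P :: "'b \<Rightarrow> 's pmf"
  assumes "0 \<le> \<beta>" "inj x" "finite S" "range x \<subseteq> S" "\<And>s. s \<in> S \<Longrightarrow> 0 \<le> D s"
    and D: "\<And>s. s \<in> S \<Longrightarrow>
      \<bar>\<beta> * (\<Sum>j\<in>UNIV. m j * pmf (P j) s) - (\<Sum>j\<in>UNIV. if x j = s then m j else 0)\<bar> \<le> D s"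
  shows "(1 - \<beta>) * (\<Sum>j\<in>UNIV. \<bar>m j\<bar>) \<le> (\<Sum>s\<in>S. D s)"
proof -
  have "\<bar>m k\<bar> \<le> \<beta> * (\<Sum>j\<in>UNIV. \<bar>m j\<bar> * pmf (P j) (x k)) + D (x k)" for k
  proof -
    have "(\<Sum>j\<in>UNIV. if x j = x k then m j else 0) = m k"
      using \<open>inj x\<close> by (simp add: inj_eq)
    moreover have "\<bar>\<Sum>j\<in>UNIV. m j * pmf (P j) (x k)\<bar> \<le> (\<Sum>j\<in>UNIV. \<bar>m j\<bar> * pmf (P j) (x k))"
      by (rule order_trans[OF sum_abs]) (simp add: abs_mult)
    then have "\<bar>\<beta> * (\<Sum>j\<in>UNIV. m j * pmf (P j) (x k))\<bar>
        \<le> \<beta> * (\<Sum>j\<in>UNIV. \<bar>m j\<bar> * pmf (P j) (x k))"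
      using \<open>0 \<le> \<beta>\<close> by (simp add: abs_mult mult_left_mono)
    ultimately show ?thesis
      using D[of "x k"] assms(4) by fastforce
  qed
  then have "(\<Sum>k\<in>UNIV. \<bar>m k\<bar>)
      \<le> (\<Sum>k\<in>UNIV. \<beta> * (\<Sum>j\<in>UNIV. \<bar>m j\<bar> * pmf (P j) (x k)) + D (x k))"
    by (rule sum_mono)
  also have "\<dots> = \<beta> * (\<Sum>j\<in>UNIV. \<bar>m j\<bar> * (\<Sum>k\<in>UNIV. pmf (P j) (x k))) + (\<Sum>s\<in>range x. D s)"
    unfolding sum.distrib sum_distrib_left sum.reindex[OF \<open>inj x\<close>] comp_def
    by (subst sum.swap) (rule refl)
  also have "\<dots> \<le> \<beta> * (\<Sum>j\<in>UNIV. \<bar>m j\<bar> * 1) + (\<Sum>s\<in>S. D s)"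
  proof (intro add_mono mult_left_mono sum_mono)
    fix j
    \<comment> \<open>As the states \<open>x k\<close> are distinct, no mass of \<open>P j\<close>
      is counted twice and the sum is a probability.\<close>
    have "(\<Sum>k\<in>UNIV. pmf (P j) (x k)) = measure (measure_pmf (P j)) (range x)"
      by (simp add: measure_measure_pmf_finite sum.reindex[OF \<open>inj x\<close>])
    then show "(\<Sum>k\<in>UNIV. pmf (P j) (x k)) \<le> 1" by simp
  next
    show "(\<Sum>s\<in>range x. D s) \<le> (\<Sum>s\<in>S. D s)"
      using assms by (intro sum_mono2) auto
  qed (use \<open>0 \<le> \<beta>\<close> in auto)
  finally show ?thesis by (simp add: algebra_simps)
qed

section \<open>Gradients of the likelihood and Bellman losses\<close>

text \<open>The log-policy is the logit minus the soft value, and the empirical probabilities sum to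
  1. In this form the loss is linear in soft values and logits, so its gradient follows from that of
  the soft value.\<close>

lemma nll_loss_eq_soft_value:
  fixes Q :: "'p \<Rightarrow> 's \<times> 'a::finite \<Rightarrow> real"
  shows "nll_loss Q X w \<pi> \<theta> =
    (\<Sum>s\<in>X. w s * (soft_value (Q \<theta>) s - (\<Sum>a\<in>UNIV. pmf (\<pi> s) a * Q \<theta> (s, a))))"
proof -
  have "(\<Sum>a\<in>UNIV. pmf p a * (- ln (policy q a s))) = soft_value q s - (\<Sum>a\<in>UNIV. pmf p a * q (s, a))"
    for p :: "'a pmf" and q :: "'s \<times> 'a \<Rightarrow> real" and s
  proof -
    have "(\<Sum>a\<in>UNIV. pmf p a * (- ln (policy q a s)))
        = (\<Sum>a\<in>UNIV. pmf p a * soft_value q s - pmf p a * q (s, a))"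
      by (simp add: ln_policy right_diff_distrib)
    also have "\<dots> = (\<Sum>a\<in>UNIV. pmf p a) * soft_value q s - (\<Sum>a\<in>UNIV. pmf p a * q (s, a))"
      by (simp only: sum_subtractf sum_distrib_right)
    finally show ?thesis by (simp only: sum_pmf_UNIV mult_1)
  qed
  then show ?thesis by (simp only: nll_loss_def)
qed

lemma gderiv_nll_loss:
  assumes g: "\<And>s a. s \<in> X \<Longrightarrow> GDERIV (\<lambda>\<theta>. Q \<theta> (s, a)) \<theta> :> g (s, a)"
  shows "GDERIV (nll_loss Q X w \<pi>) \<theta> :>
    (\<Sum>s\<in>X. \<Sum>a\<in>UNIV. (w s * (policy (Q \<theta>) a s - pmf (\<pi> s) a)) *\<^sub>R g (s, a))"
proof -
  have "GDERIV (nll_loss Q X w \<pi>) \<theta> :>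
    (\<Sum>s\<in>X. w s *\<^sub>R ((\<Sum>a\<in>UNIV. policy (Q \<theta>) a s *\<^sub>R g (s, a))
      - (\<Sum>a\<in>UNIV. pmf (\<pi> s) a *\<^sub>R g (s, a))))"
    unfolding nll_loss_eq_soft_value[abs_def]
    by (intro gderiv_sum gderiv_cmult GDERIV_diff gderiv_soft_value g)
  then show ?thesis
    by (simp only: sum_subtractf scaleR_sum_right scaleR_diff_left scaleR_diff_right right_diff_distrib
        scaleR_scaleR)
qed

lemma gderiv_be_loss:
  assumes g: "\<And>s a. s \<in> range x \<union> (\<Union>j. set_pmf (P j)) \<Longrightarrow> GDERIV (\<lambda>\<theta>. Q \<theta> (s, a)) \<theta> :> g (s, a)"
  shows "GDERIV (be_loss \<beta> anchor Q x w P r) \<theta> :>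
    (\<Sum>j\<in>UNIV. (2 * (w j * bellman_residual \<beta> anchor Q x P r j \<theta>)) *\<^sub>R
      (\<beta> *\<^sub>R (\<Sum>y\<in>set_pmf (P j). pmf (P j) y *\<^sub>R (\<Sum>a\<in>UNIV. policy (Q \<theta>) a y *\<^sub>R g (y, a)))
        - g (x j, anchor (x j))))"
proof -
  have "GDERIV (bellman_residual \<beta> anchor Q x P r j) \<theta> :>
      0 + \<beta> *\<^sub>R (\<Sum>y\<in>set_pmf (P j). pmf (P j) y *\<^sub>R (\<Sum>a\<in>UNIV. policy (Q \<theta>) a y *\<^sub>R g (y, a)))
        - g (x j, anchor (x j))" for j
    unfolding bellman_residual_def[abs_def]
    by (intro GDERIV_diff GDERIV_add GDERIV_const gderiv_cmult gderiv_sum gderiv_soft_value; rule g; blast)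
  then have "GDERIV (be_loss \<beta> anchor Q x w P r) \<theta> :>
    (\<Sum>j\<in>UNIV. w j *\<^sub>R (2 * bellman_residual \<beta> anchor Q x P r j \<theta>) *\<^sub>R
      (0 + \<beta> *\<^sub>R (\<Sum>y\<in>set_pmf (P j). pmf (P j) y *\<^sub>R (\<Sum>a\<in>UNIV. policy (Q \<theta>) a y *\<^sub>R g (y, a)))
        - g (x j, anchor (x j))))"
    unfolding be_loss_def[abs_def]
    by (intro gderiv_sum gderiv_cmult gderiv_power2)
  then show ?thesis
    by (simp add: mult_ac)
qed

section \<open>Bounding both losses by gradient coefficients\<close>

text \<open>For each pair the policy is a continuous positive function of the parameter, so it
  attains a positive minimum on a nonempty compact set. Finitely many pairs then share one
  bound.\<close>

lemma policy_lower_bound: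
  fixes Q :: "'p::metric_space \<Rightarrow> 's \<times> 'a::finite \<Rightarrow> real"
  assumes "compact B" "finite X" and cont: "\<And>s a. s \<in> X \<Longrightarrow> continuous_on B (\<lambda>\<theta>. Q \<theta> (s, a))"
  obtains \<delta> where "\<delta> > 0" "\<And>\<theta> s a. \<theta> \<in> B \<Longrightarrow> s \<in> X \<Longrightarrow> \<delta> \<le> policy (Q \<theta>) a s"
proof -
  have "\<exists>\<delta>>0. \<forall>\<theta>\<in>B. \<delta> \<le> policy (Q \<theta>) (snd z) (fst z)" if "z \<in> X \<times> UNIV" for z :: "'s \<times> 'a"
  proof (cases "B = {}")
    case False
    have "\<forall>\<theta>\<in>B. (\<Sum>b\<in>UNIV. exp (Q \<theta> (fst z, b))) \<noteq> 0"
    proof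
      show "(\<Sum>b\<in>UNIV. exp (Q \<theta> (fst z, b))) \<noteq> 0" for \<theta>
        by (rule less_imp_neq[THEN not_sym]) (rule sum_exp_pos)
    qed
    moreover have "continuous_on B (\<lambda>\<theta>. Q \<theta> (fst z, b))" for b
      using that by (intro cont) (simp add: mem_Times_iff)
    ultimately have "continuous_on B (\<lambda>\<theta>. policy (Q \<theta>) (snd z) (fst z))"
      unfolding policy_def
      by (intro continuous_on_divide continuous_on_sum continuous_on_exp)
    then obtain \<theta> where "\<forall>\<theta>'\<in>B. policy (Q \<theta>) (snd z) (fst z) \<le> policy (Q \<theta>') (snd z) (fst z)"
      using continuous_attains_inf[OF \<open>compact B\<close> False] by blast
    then show ?thesis
      by (intro exI[of _ "policy (Q \<theta>) (snd z) (fst z)"] conjI policy_pos)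
  next
    case True
    then show ?thesis by (intro exI[of _ 1]) simp
  qed
  note lower = this
  show thesis
  proof (rule finite_family_positive_lower_bound[OF _ lower])
    show "finite (X \<times> (UNIV :: 'a set))" using \<open>finite X\<close> by simp
    fix \<delta> assume \<delta>: "\<delta> > 0"
      "\<And>z \<theta>. z \<in> X \<times> UNIV \<Longrightarrow> \<theta> \<in> B \<Longrightarrow> \<delta> \<le> policy (Q \<theta>) (snd z) (fst z)"
    show thesis
      using \<delta>(2)[of "(_, _)"] by (intro that[OF \<delta>(1)]) simp
  qed
qed

text \<open>The value that the likelihood loss would have if the policy equalled the empirical
  action distributions. It serves as a reference value that does not depend on the
  parameter.\<close>

definition nll_entropy :: "'s set \<Rightarrow> ('s \<Rightarrow> real) \<Rightarrow> ('s \<Rightarrow> 'a::finite pmf) \<Rightarrow> real" where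
  "nll_entropy X w \<pi> = (\<Sum>s\<in>X. w s * (\<Sum>a\<in>UNIV. pmf (\<pi> s) a * (- ln (pmf (\<pi> s) a))))"

lemma nll_entropy_le_nll_loss:
  assumes "\<And>s. s \<in> X \<Longrightarrow> 0 \<le> w s"
  shows "nll_entropy X w \<pi> \<le> nll_loss Q X w \<pi> \<theta>"
  unfolding nll_entropy_def nll_loss_def
  by (intro sum_mono mult_left_mono gibbs_inequality policy_pos sum_policy assms)

text \<open>The excess is a weighted Kullback--Leibler divergence, hence at most the weighted
  chi-square divergence.\<close>

lemma nll_excess_le:
  assumes "\<And>s. s \<in> X \<Longrightarrow> \<delta>\<^sub>w \<le> w s" "0 < \<delta>\<^sub>w"
    and "\<And>s a. s \<in> X \<Longrightarrow> \<delta>\<^sub>p \<le> policy (Q \<theta>) a s" "0 < \<delta>\<^sub>p"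
    and U: "\<And>s a. s \<in> X \<Longrightarrow> \<bar>w s * (policy (Q \<theta>) a s - pmf (\<pi> s) a)\<bar> \<le> U"
  shows "nll_loss Q X w \<pi> \<theta> - nll_entropy X w (\<pi> :: _ \<Rightarrow> 'a::finite pmf)
    \<le> real (card X) * (real CARD('a) * (U\<^sup>2 / (\<delta>\<^sub>w * \<delta>\<^sub>p)))"
proof -
  have "nll_loss Q X w \<pi> \<theta> - nll_entropy X w \<pi> = (\<Sum>s\<in>X. w s *
      ((\<Sum>a\<in>UNIV. pmf (\<pi> s) a * (- ln (policy (Q \<theta>) a s)))
        - (\<Sum>a\<in>UNIV. pmf (\<pi> s) a * (- ln (pmf (\<pi> s) a)))))"
    unfolding nll_loss_def nll_entropy_def by (simp add: sum_subtractf right_diff_distrib)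
  also have "\<dots> \<le> (\<Sum>s\<in>X. real CARD('a) * (U\<^sup>2 / (\<delta>\<^sub>w * \<delta>\<^sub>p)))"
  proof (rule sum_mono)
    fix s assume s: "s \<in> X"
    have w: "0 < w s" using assms(1)[OF s] \<open>0 < \<delta>\<^sub>w\<close> by simp
    have "w s * ((\<Sum>a\<in>UNIV. pmf (\<pi> s) a * (- ln (policy (Q \<theta>) a s)))
        - (\<Sum>a\<in>UNIV. pmf (\<pi> s) a * (- ln (pmf (\<pi> s) a))))
      \<le> w s * (\<Sum>a\<in>UNIV. (policy (Q \<theta>) a s - pmf (\<pi> s) a)\<^sup>2 / policy (Q \<theta>) a s)"
      using w by (intro mult_left_mono kl_le_chi_square policy_pos sum_policy) auto
    \<comment> \<open>Expanding each fraction by the weight turns the numerator into the square of a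
      likelihood gradient coefficient, which \<open>U\<close> controls, and leaves a denominator of
      at least \<open>\<delta>\<^sub>w * \<delta>\<^sub>p\<close>.\<close>
    also have "\<dots> = (\<Sum>a\<in>UNIV. (w s * (policy (Q \<theta>) a s - pmf (\<pi> s) a))\<^sup>2 / (w s * policy (Q \<theta>) a s))"
      unfolding sum_distrib_left using w by (intro sum.cong) (auto simp: power2_eq_square)
    also have "\<dots> \<le> (\<Sum>a\<in>(UNIV :: 'a set). U\<^sup>2 / (\<delta>\<^sub>w * \<delta>\<^sub>p))"
      using assms s w by (intro sum_mono frac_le mult_mono abs_le_square_iff[THEN iffD1])
        (auto intro: order_trans[OF _ abs_ge_self])
    finally show "w s * ((\<Sum>a\<in>UNIV. pmf (\<pi> s) a * (- ln (policy (Q \<theta>) a s)))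
        - (\<Sum>a\<in>UNIV. pmf (\<pi> s) a * (- ln (pmf (\<pi> s) a))))
      \<le> real CARD('a) * (U\<^sup>2 / (\<delta>\<^sub>w * \<delta>\<^sub>p))" by simp
  qed
  finally show ?thesis by simp
qed

text \<open>With m = w \<Psi>, each summand w \<Psi>^2 equals m^2 / w. The weights are bounded
  below, and the l2 norm of m is at most its l1 norm, the norm in which the contraction argument
  works.\<close>

lemma be_loss_le:
  assumes "\<And>j. \<delta> \<le> w j" "0 < \<delta>"
    and "(\<Sum>j\<in>UNIV. \<bar>w j * bellman_residual \<beta> anchor Q x P r j \<theta>\<bar>) \<le> L"
  shows "be_loss \<beta> anchor Q x w P r \<theta> \<le> L\<^sup>2 / \<delta>"
proof -
  let ?m = "\<lambda>j. w j * bellman_residual \<beta> anchor Q x P r j \<theta>"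
  have w: "0 < w j" for j using assms(1)[of j] \<open>0 < \<delta>\<close> by simp
  have "be_loss \<beta> anchor Q x w P r \<theta> = (\<Sum>j\<in>UNIV. (?m j)\<^sup>2 / w j)"
    unfolding be_loss_def using w by (intro sum.cong) (auto simp: power2_eq_square less_imp_neq[symmetric])
  also have "\<dots> \<le> (\<Sum>j\<in>UNIV. \<bar>?m j\<bar>\<^sup>2 / \<delta>)"
    using assms w by (intro sum_mono frac_le) auto
  also have "\<dots> = (\<Sum>j\<in>UNIV. \<bar>?m j\<bar>\<^sup>2) / \<delta>"
    by (simp add: sum_divide_distrib)
  also have "\<dots> \<le> (\<Sum>j\<in>UNIV. \<bar>?m j\<bar>)\<^sup>2 / \<delta>"
    using \<open>0 < \<delta>\<close> by (intro divide_right_mono sum_power2_le_power2_sum) auto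
  also have "\<dots> \<le> L\<^sup>2 / \<delta>"
    using assms by (intro divide_right_mono power_mono) (auto intro: sum_nonneg)
  finally show ?thesis .
qed

section \<open>The gradient of the Q-objective as one combination over state-action pairs\<close>

text \<open>Conditioning applies only to a combination with a single coefficient per pair. Three
  contributions are merged: the likelihood at sampled states, the next states entering through the
  soft value (hence the policy factor), and the anchored current pairs.\<close>

lemma gderiv_nll_be_loss:
  fixes X :: "'s set" and x :: "'b::finite \<Rightarrow> 's" and P :: "'b \<Rightarrow> 's pmf"
    and anchor :: "'s \<Rightarrow> 'a::finite" and Q :: "'p::real_inner \<Rightarrow> 's \<times> 'a \<Rightarrow> real"
    and \<beta> :: real and w r :: "'b \<Rightarrow> real" and \<theta> :: 'p
  assumes S: "finite S" "X \<subseteq> S" "range x \<subseteq> S" "\<And>j. set_pmf (P j) \<subseteq> S"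
    and g: "\<And>s a. s \<in> S \<Longrightarrow> GDERIV (\<lambda>\<theta>. Q \<theta> (s, a)) \<theta> :> g (s, a)"
  defines "m \<equiv> \<lambda>j. w j * bellman_residual \<beta> anchor Q x P r j \<theta>"
  shows "GDERIV (\<lambda>\<theta>. nll_loss Q X u \<pi> \<theta> + be_loss \<beta> anchor Q x w P r \<theta>) \<theta> :>
    (\<Sum>s\<in>S. \<Sum>a\<in>UNIV.
      ((if s \<in> X then u s * (policy (Q \<theta>) a s - pmf (\<pi> s) a) else 0)
        + 2 * \<beta> * policy (Q \<theta>) a s * (\<Sum>j\<in>UNIV. m j * pmf (P j) s)
        - 2 * (\<Sum>j\<in>UNIV. if x j = s \<and> anchor s = a then m j else 0)) *\<^sub>R g (s, a))"
proof -
  define G where "G s = (\<Sum>a\<in>UNIV. policy (Q \<theta>) a s *\<^sub>R g (s, a))" for s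
  have nll: "(\<Sum>s\<in>X. \<Sum>a\<in>UNIV. (u s * (policy (Q \<theta>) a s - pmf (\<pi> s) a)) *\<^sub>R g (s, a))
    = (\<Sum>s\<in>S. \<Sum>a\<in>UNIV.
        (if s \<in> X then u s * (policy (Q \<theta>) a s - pmf (\<pi> s) a) else 0) *\<^sub>R g (s, a))"
    using S by (intro sum.mono_neutral_cong_left) auto
  \<comment> \<open>Each support is enlarged to the common set \<open>S\<close>, where the
    additional probabilities are 0.\<close>
  have next_states: "(\<Sum>y\<in>set_pmf (P j). pmf (P j) y *\<^sub>R G y) = (\<Sum>s\<in>S. pmf (P j) s *\<^sub>R G s)" for j
    using S by (intro sum.mono_neutral_left) (auto simp: set_pmf_iff)
  have "(\<Sum>j\<in>UNIV. (2 * m j) *\<^sub>R \<beta> *\<^sub>R (\<Sum>s\<in>S. pmf (P j) s *\<^sub>R G s))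
    = (\<Sum>s\<in>S. \<Sum>j\<in>UNIV. (2 * m j * \<beta> * pmf (P j) s) *\<^sub>R G s)"
    unfolding scaleR_sum_right by (subst sum.swap) (simp add: mult.assoc)
  also have "\<dots> = (\<Sum>s\<in>S. \<Sum>a\<in>UNIV.
      (2 * \<beta> * policy (Q \<theta>) a s * (\<Sum>j\<in>UNIV. m j * pmf (P j) s)) *\<^sub>R g (s, a))"
    unfolding scaleR_sum_left[symmetric] unfolding G_def scaleR_sum_right
    by (intro sum.cong refl) (simp add: sum_distrib_left sum_distrib_right mult_ac)
  finally have next_sum: "(\<Sum>j\<in>UNIV. (2 * m j) *\<^sub>R \<beta> *\<^sub>R (\<Sum>s\<in>S. pmf (P j) s *\<^sub>R G s)) = \<dots>" .
  \<comment> \<open>Evaluation at one state is written as an indicator sum over \<open>S\<close>, so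
    that the anchored terms can be regrouped by pair.\<close>
  have point: "v (x j) = (\<Sum>s\<in>S. if x j = s then v s else 0)" for v :: "'s \<Rightarrow> 'p" and j
    using S(1,3) by (simp add: sum.delta' range_subsetD)
  have "(2 * m j) *\<^sub>R g (x j, anchor (x j))
      = (\<Sum>s\<in>S. \<Sum>a\<in>UNIV. (2 * (if x j = s \<and> anchor s = a then m j else 0)) *\<^sub>R g (s, a))" for j
  proof -
    have "(\<Sum>a\<in>UNIV. (2 * (if x j = s \<and> anchor s = a then m j else 0)) *\<^sub>R g (s, a))
      = (\<Sum>a\<in>UNIV. if anchor s = a then if x j = s then (2 * m j) *\<^sub>R g (s, a) else 0 else 0)" for s
      by (intro sum.cong) auto
    then show ?thesis
      using point[of "\<lambda>s. (2 * m j) *\<^sub>R g (s, anchor s)" j] by simp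
  qed
  then have "(\<Sum>j\<in>UNIV. (2 * m j) *\<^sub>R g (x j, anchor (x j)))
      = (\<Sum>s\<in>S. \<Sum>j\<in>UNIV. \<Sum>a\<in>UNIV. (2 * (if x j = s \<and> anchor s = a then m j else 0)) *\<^sub>R g (s, a))"
    by (simp add: sum.swap[of _ S])
  also have "\<dots> = (\<Sum>s\<in>S. \<Sum>a\<in>UNIV. \<Sum>j\<in>UNIV. (2 * (if x j = s \<and> anchor s = a then m j else 0)) *\<^sub>R g (s, a))"
    by (intro sum.cong refl sum.swap)
  also have "\<dots> = (\<Sum>s\<in>S. \<Sum>a\<in>UNIV.
      (2 * (\<Sum>j\<in>UNIV. if x j = s \<and> anchor s = a then m j else 0)) *\<^sub>R g (s, a))"
    by (simp add: sum_distrib_left scaleR_sum_left)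
  finally have anchor_sum: "(\<Sum>j\<in>UNIV. (2 * m j) *\<^sub>R g (x j, anchor (x j))) = \<dots>" .
  have "GDERIV (\<lambda>\<theta>. nll_loss Q X u \<pi> \<theta> + be_loss \<beta> anchor Q x w P r \<theta>) \<theta> :>
    (\<Sum>s\<in>X. \<Sum>a\<in>UNIV. (u s * (policy (Q \<theta>) a s - pmf (\<pi> s) a)) *\<^sub>R g (s, a))
    + (\<Sum>j\<in>UNIV. (2 * m j) *\<^sub>R
        (\<beta> *\<^sub>R (\<Sum>y\<in>set_pmf (P j). pmf (P j) y *\<^sub>R G y) - g (x j, anchor (x j))))"
    unfolding m_def G_def by (intro GDERIV_add gderiv_nll_loss gderiv_be_loss g) (use S in auto)
  then show ?thesis
    unfolding scaleR_diff_right sum_subtractf next_states next_sum anchor_sum nll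
    by (simp only: sum.distrib sum_subtractf scaleR_add_left scaleR_diff_left add_diff_eq)
qed

text \<open>Summing over the actions of one state removes the likelihood part \<open>d\<close>,
  turns the policy factor into 1, and meets the anchor action exactly once. What remains is twice
  one entry of the contraction system for \<open>m\<close>.\<close>

lemma sum_block_coefficients:
  fixes c :: "'a::finite \<Rightarrow> real"
  assumes "(\<Sum>a\<in>UNIV. p a) = 1" "(\<Sum>a\<in>UNIV. d a) = 0"
    and "\<And>a. c a = d a + 2 * \<beta> * p a * K - 2 * (\<Sum>j\<in>UNIV. if x j = s \<and> anchor s = a then m j else 0)"
  shows "(\<Sum>a\<in>UNIV. c a) = 2 * (\<beta> * K - (\<Sum>j\<in>(UNIV :: 'b::finite set). if x j = s then m j else 0))"
proof -
  have "(\<Sum>a\<in>UNIV. \<Sum>j\<in>UNIV. if x j = s \<and> anchor s = a then m j else 0)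
      = (\<Sum>j\<in>UNIV. \<Sum>a\<in>UNIV. if anchor s = a then if x j = s then m j else 0 else 0)"
    by (subst sum.swap) (intro sum.cong, auto)
  also have "\<dots> = (\<Sum>j\<in>UNIV. if x j = s then m j else 0)"
    by simp
  finally have "(\<Sum>a\<in>UNIV. \<Sum>j\<in>UNIV. if x j = s \<and> anchor s = a then m j else 0) = \<dots>" .
  moreover have "(\<Sum>a\<in>UNIV. 2 * \<beta> * p a * K) = 2 * \<beta> * K"
    using assms(1) by (simp add: sum_distrib_left[symmetric] sum_distrib_right[symmetric])
  ultimately show ?thesis
    using assms(2) by (simp add: assms(3) sum.distrib sum_subtractf sum_distrib_left[symmetric])
qed

section \<open>The Polyak--Lojasiewicz inequality for the Q-objective\<close>

lemma nll_be_loss_PL: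
  fixes Q :: "real ^ 'd \<Rightarrow> 's \<times> 'a::finite \<Rightarrow> real"
    and x :: "'b::finite \<Rightarrow> 's" and P :: "'b \<Rightarrow> 's pmf" and z :: "'m::finite \<Rightarrow> 's \<times> 'a"
  assumes \<beta>: "0 < \<beta>" "\<beta> < 1" and B: "compact B"
    and X: "finite X" "\<And>s. s \<in> X \<Longrightarrow> 0 < u s"
    and x: "inj x" "\<And>j. 0 < w j" "\<And>j. finite (set_pmf (P j))"
    and z: "bij_betw z UNIV (eval_pairs X x P)"
    and C2: "\<And>p. p \<in> eval_pairs X x P \<Longrightarrow> C2_on B (\<lambda>\<theta>. Q \<theta> p)"
    and cond: "jacobian_conditioned B z Q"
  shows "\<exists>c>0. PL_inequality_on B
    (\<lambda>\<theta>. nll_loss Q X u \<pi> \<theta> + be_loss \<beta> anchor Q x w P r \<theta>) c"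
proof -
  define S where "S = X \<union> range x \<union> (\<Union>j. set_pmf (P j))"
  have Z: "eval_pairs X x P = S \<times> (UNIV :: 'a set)" by (simp add: eval_pairs_def S_def)
  have S: "finite S" "X \<subseteq> S" "range x \<subseteq> S" "\<And>j. set_pmf (P j) \<subseteq> S"
    using X x by (auto simp: S_def)
  define g where "g \<theta> p = gradient (\<lambda>\<theta>. Q \<theta> p) \<theta>" for \<theta> p
  have g: "GDERIV (\<lambda>\<theta>. Q \<theta> p) \<theta> :> g \<theta> p" if "\<theta> \<in> B" "p \<in> S \<times> UNIV" for \<theta> p
    using C2_on_gderiv[OF C2 \<open>\<theta> \<in> B\<close>] that by (simp add: g_def Z)
  have zS: "z i \<in> S \<times> UNIV" for i using z by (auto simp: Z bij_betw_def)
  obtain \<mu> where \<mu>: "\<mu> > 0" and cond': "\<And>\<theta> c. \<theta> \<in> B \<Longrightarrow>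
      \<mu> * (\<Sum>i\<in>UNIV. (c i)\<^sup>2) \<le> (norm (\<Sum>i\<in>UNIV. c i *\<^sub>R g \<theta> (z i)))\<^sup>2"
    by (rule jacobian_conditionedE[of B z Q "\<lambda>\<theta> i. g \<theta> (z i)", OF cond g[OF _ zS]]) blast+
  \<comment> \<open>Bijectivity of the enumeration \<open>z\<close> lets the row index be traded for
    a double sum in which every pair occurs exactly once.\<close>
  have conditioned: "\<mu> * (\<Sum>s\<in>S. \<Sum>a\<in>UNIV. (c s a)\<^sup>2)
      \<le> (norm (\<Sum>s\<in>S. \<Sum>a\<in>UNIV. c s a *\<^sub>R g \<theta> (s, a)))\<^sup>2" if "\<theta> \<in> B" for \<theta> c
    using cond'[OF that, of "\<lambda>i. case_prod c (z i)"]
      sum.reindex_bij_betw[OF z, of "\<lambda>p. (case_prod c p)\<^sup>2"]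
      sum.reindex_bij_betw[OF z, of "\<lambda>p. case_prod c p *\<^sub>R g \<theta> p"]
    unfolding Z by (simp add: sum.cartesian_product case_prod_unfold)
  obtain \<delta>\<^sub>u where \<delta>\<^sub>u: "\<delta>\<^sub>u > 0" "\<And>s. s \<in> X \<Longrightarrow> \<delta>\<^sub>u \<le> u s"
    using finite_positive_lower_bound[of X u] X by blast
  obtain \<delta>\<^sub>w where \<delta>\<^sub>w: "\<delta>\<^sub>w > 0" "\<And>j. \<delta>\<^sub>w \<le> w j"
    by (rule finite_positive_lower_bound[of UNIV w]) (use x in auto)
  have "continuous_on B (\<lambda>\<theta>. Q \<theta> (s, a))" if "s \<in> X" for s a
    using g that S(2) by (intro continuous_at_imp_continuous_on ballI)
      (auto simp: gderiv_def intro!: has_derivative_continuous)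
  then obtain \<delta>\<^sub>p where \<delta>\<^sub>p: "\<delta>\<^sub>p > 0" "\<And>\<theta> s a. \<theta> \<in> B \<Longrightarrow> s \<in> X \<Longrightarrow> \<delta>\<^sub>p \<le> policy (Q \<theta>) a s"
    using policy_lower_bound[OF B X(1)] by metis
  \<comment> \<open>With \<open>T\<close> the l1 norm of the coefficients \<open>c\<close>, the
    likelihood part is at most T + 4 |m|_1, and |m|_1 <= T / (2 (1 - \<beta>)); together this is
    \<open>K * T\<close>.\<close>
  define K where "K = 1 + 2 / (1 - \<beta>)"
  \<comment> \<open>Chosen so that the gap is at most C T^2. The first summand is the likelihood
    excess with \<open>U = K * T\<close>, the second the Bellman loss with
    \<open>L = T / (2 * (1 - \<beta>))\<close>.\<close>
  define C where "C = real (card X) * (real CARD('a) * (K\<^sup>2 / (\<delta>\<^sub>u * \<delta>\<^sub>p))) + (1 / (2 * (1 - \<beta>)))\<^sup>2 / \<delta>\<^sub>w"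
  define n where "n = real (card S * CARD('a))"
  let ?R = "\<lambda>\<theta>. nll_loss Q X u \<pi> \<theta> + be_loss \<beta> anchor Q x w P r \<theta>"
  \<comment> \<open>The Bellman summand is strictly positive, so this holds even if \<open>X\<close>
    is empty.\<close>
  have "C > 0" unfolding C_def using \<delta>\<^sub>u \<delta>\<^sub>p \<delta>\<^sub>w \<beta> by (intro add_nonneg_pos) auto
  have "S \<noteq> {}" using S(3) by blast
  with S(1) have "n > 0" by (simp add: n_def card_gt_0_iff)
  \<comment> \<open>The gap is at most C n times the sum of squared coefficients, hence at most C n
    / \<mu> times the squared gradient norm; inverting and halving gives the constant.\<close>
  have "PL_inequality_on B ?R (\<mu> / (2 * C * n))"
  proof (rule PL_inequality_onI)
    fix \<theta> assume \<theta>: "\<theta> \<in> B"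
    have "be_loss \<beta> anchor Q x w P r \<theta> \<ge> 0"
      unfolding be_loss_def by (intro sum_nonneg mult_nonneg_nonneg) (auto simp: less_imp_le x)
    then show "nll_entropy X u \<pi> \<le> ?R \<theta>"
      using nll_entropy_le_nll_loss[of X u \<pi> Q \<theta>] X(2) by (fastforce intro: less_imp_le)
    define m where "m j = w j * bellman_residual \<beta> anchor Q x P r j \<theta>" for j
    define d where "d s a = (if s \<in> X then u s * (policy (Q \<theta>) a s - pmf (\<pi> s) a) else 0)" for s a
    define c where "c s a = d s a + 2 * \<beta> * policy (Q \<theta>) a s * (\<Sum>j\<in>UNIV. m j * pmf (P j) s)
        - 2 * (\<Sum>j\<in>UNIV. if x j = s \<and> anchor s = a then m j else 0)" for s a
    define T where "T = (\<Sum>s\<in>S. \<Sum>a\<in>UNIV. \<bar>c s a\<bar>)"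
    have grad: "gradient ?R \<theta> = (\<Sum>s\<in>S. \<Sum>a\<in>UNIV. c s a *\<^sub>R g \<theta> (s, a))"
      unfolding c_def d_def m_def
      by (intro gradient_eqI gderiv_nll_be_loss[OF S] g \<theta>) auto
    have "(\<Sum>a\<in>UNIV. d s a) = 0" for s
      by (cases "s \<in> X")
        (simp_all add: d_def sum_distrib_left[symmetric] sum_subtractf sum_policy sum_pmf_UNIV)
    then have block: "(\<Sum>a\<in>UNIV. c s a)
        = 2 * (\<beta> * (\<Sum>j\<in>UNIV. m j * pmf (P j) s) - (\<Sum>j\<in>UNIV. if x j = s then m j else 0))" for s
      by (rule sum_block_coefficients[OF sum_policy _ c_def])
    \<comment> \<open>Each block sum is at most the l1 norm of its block; the factor 2 in
      \<open>block\<close> accounts for the division by 2.\<close>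
    have "(1 - \<beta>) * (\<Sum>j\<in>UNIV. \<bar>m j\<bar>) \<le> (\<Sum>s\<in>S. (\<Sum>a\<in>UNIV. \<bar>c s a\<bar>) / 2)"
    proof (rule bellman_contraction[OF _ x(1) S(1,3)])
      fix s
      have "\<bar>\<Sum>a\<in>UNIV. c s a\<bar> \<le> (\<Sum>a\<in>UNIV. \<bar>c s a\<bar>)" by (rule sum_abs)
      then show "\<bar>\<beta> * (\<Sum>j\<in>UNIV. m j * pmf (P j) s) - (\<Sum>j\<in>UNIV. if x j = s then m j else 0)\<bar>
          \<le> (\<Sum>a\<in>UNIV. \<bar>c s a\<bar>) / 2"
        unfolding block abs_mult by simp
    qed (use \<beta> in \<open>auto intro: sum_nonneg\<close>)
    then have m: "(\<Sum>j\<in>UNIV. \<bar>m j\<bar>) \<le> 1 / (2 * (1 - \<beta>)) * T"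
      using \<beta> by (simp add: T_def sum_divide_distrib[symmetric] field_simps)
    have "be_loss \<beta> anchor Q x w P r \<theta> \<le> (1 / (2 * (1 - \<beta>)) * T)\<^sup>2 / \<delta>\<^sub>w"
      by (rule be_loss_le[OF \<delta>\<^sub>w(2,1)]) (use m in \<open>simp add: m_def\<close>)
    \<comment> \<open>The likelihood part is recovered from \<open>c\<close> by removing the two
      Bellman terms, each at most twice the l1 norm of \<open>m\<close>.\<close>
    moreover have "\<bar>u s * (policy (Q \<theta>) a s - pmf (\<pi> s) a)\<bar> \<le> K * T" if s: "s \<in> X" for s a
    proof -
      have "\<bar>c s a\<bar> \<le> (\<Sum>a\<in>UNIV. \<bar>c s a\<bar>)" by (rule member_le_sum) auto
      also have "\<dots> \<le> T"
        unfolding T_def using s S by (intro member_le_sum) (auto intro: sum_nonneg)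
      finally have c: "\<bar>c s a\<bar> \<le> T" .
      have "\<bar>\<Sum>j\<in>UNIV. m j * pmf (P j) s\<bar> \<le> (\<Sum>j\<in>UNIV. \<bar>m j\<bar>)"
        by (rule order_trans[OF sum_abs sum_mono]) (simp add: abs_mult mult_left_le pmf_le_1)
      then have "(\<beta> * policy (Q \<theta>) a s) * \<bar>\<Sum>j\<in>UNIV. m j * pmf (P j) s\<bar> \<le> 1 * (\<Sum>j\<in>UNIV. \<bar>m j\<bar>)"
        using \<beta> policy_pos[of "Q \<theta>" a s] policy_le_1[of "Q \<theta>" a s]
        by (intro mult_mono mult_le_one) (auto intro: less_imp_le sum_nonneg)
      then have a1: "\<bar>\<beta> * policy (Q \<theta>) a s * (\<Sum>j\<in>UNIV. m j * pmf (P j) s)\<bar> \<le> (\<Sum>j\<in>UNIV. \<bar>m j\<bar>)"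
        using \<beta> policy_pos[of "Q \<theta>" a s] by (simp add: abs_mult)
      have a2: "\<bar>\<Sum>j\<in>UNIV. if x j = s \<and> anchor s = a then m j else 0\<bar> \<le> (\<Sum>j\<in>UNIV. \<bar>m j\<bar>)"
        by (rule order_trans[OF sum_abs sum_mono]) auto
      have "\<bar>d s a\<bar> \<le> T + 4 * (\<Sum>j\<in>UNIV. \<bar>m j\<bar>)"
        using c a1 a2 c_def[of s a] by linarith
      also have "\<dots> \<le> T + 4 * (1 / (2 * (1 - \<beta>)) * T)" using m by simp
      also have "\<dots> = K * T" using \<beta> by (simp add: K_def field_simps)
      finally show ?thesis using s by (simp add: d_def)
    qed
    then have "nll_loss Q X u \<pi> \<theta> - nll_entropy X u \<pi>
        \<le> real (card X) * (real CARD('a) * ((K * T)\<^sup>2 / (\<delta>\<^sub>u * \<delta>\<^sub>p)))"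
      by (intro nll_excess_le \<delta>\<^sub>u \<delta>\<^sub>p \<theta>)
    ultimately have "?R \<theta> - nll_entropy X u \<pi> \<le> C * T\<^sup>2"
      by (simp add: C_def power_mult_distrib power_divide distrib_right mult.assoc)
    \<comment> \<open>Cauchy--Schwarz over the \<open>n\<close> pairs returns from the l1 norm to
      the sum of squares needed for conditioning.\<close>
    also have "T\<^sup>2 \<le> n * (\<Sum>s\<in>S. \<Sum>a\<in>UNIV. (c s a)\<^sup>2)"
      using sum_squared_le_sum_of_squares[of "\<lambda>(s, a). \<bar>c s a\<bar>" "S \<times> UNIV"]
      by (simp add: T_def n_def sum.cartesian_product case_prod_unfold card_cartesian_product mult.commute)
    finally have "?R \<theta> - nll_entropy X u \<pi> \<le> C * (n * (\<Sum>s\<in>S. \<Sum>a\<in>UNIV. (c s a)\<^sup>2))"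
      using \<open>C > 0\<close> by simp
    then have "\<mu> / (2 * C * n) * (?R \<theta> - nll_entropy X u \<pi>)
        \<le> \<mu> / (2 * C * n) * (C * (n * (\<Sum>s\<in>S. \<Sum>a\<in>UNIV. (c s a)\<^sup>2)))"
      using \<open>C > 0\<close> \<open>n > 0\<close> \<mu> by (intro mult_left_mono) auto
    also have "\<dots> = 1 / 2 * (\<mu> * (\<Sum>s\<in>S. \<Sum>a\<in>UNIV. (c s a)\<^sup>2))"
      using \<open>C > 0\<close> \<open>n > 0\<close> by simp
    also have "\<dots> \<le> 1 / 2 * (norm (gradient ?R \<theta>))\<^sup>2"
      using conditioned[OF \<theta>, of c] by (simp add: grad)
    finally show "\<mu> / (2 * C * n) * (?R \<theta> - nll_entropy X u \<pi>) \<le> 1 / 2 * (norm (gradient ?R \<theta>))\<^sup>2" .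
  qed (use \<mu> \<open>C > 0\<close> \<open>n > 0\<close> in auto)
  then show ?thesis
    using \<mu> \<open>C > 0\<close> \<open>n > 0\<close> by (intro exI[of _ "\<mu> / (2 * C * n)"]) auto
qed

theorem theorem11:
  fixes \<beta> :: real
    and anchor :: "'s \<Rightarrow> 'a::finite"
    and Q :: "real ^ 'd \<Rightarrow> 's \<times> 'a \<Rightarrow> real"
    and \<zeta> :: "real ^ 'e \<Rightarrow> 's \<times> 'a \<Rightarrow> real"
    and X_NLL :: "'s set" and w_NLL :: "'s \<Rightarrow> real" and \<pi> :: "'s \<Rightarrow> 'a pmf"
    and x_BE :: "'b::finite \<Rightarrow> 's" and w_BE :: "'b \<Rightarrow> real"
    and P :: "'b \<Rightarrow> 's pmf" and r :: "'b \<Rightarrow> real"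
    and z_\<zeta> :: "'g::finite \<Rightarrow> 's \<times> 'a" and w_\<zeta> :: "'g \<Rightarrow> real" and N :: "'g \<Rightarrow> 's multiset"
    and z_Q :: "'m::finite \<Rightarrow> 's \<times> 'a"
    and \<theta>\<^sub>0 :: "real ^ 'd" and R_Q :: real and \<phi>\<^sub>0 :: "real ^ 'e" and R_\<zeta> :: real
    and \<theta>_iterates \<theta>_minimizers :: "(real ^ 'd) set"
    and \<phi>_iterates \<phi>_minimizers :: "(real ^ 'e) set"
  defines "B_Q \<equiv> cball \<theta>\<^sub>0 R_Q"
    and "B_\<zeta> \<equiv> cball \<phi>\<^sub>0 R_\<zeta>"
    and "R_hat \<equiv> \<lambda>\<theta>. nll_loss Q X_NLL w_NLL \<pi> \<theta> + be_loss \<beta> anchor Q x_BE w_BE P r \<theta>"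
    and "F_hat \<equiv> aux_loss \<beta> Q \<zeta> z_\<zeta> w_\<zeta> N"
  assumes beta: "0 < \<beta>" "\<beta> < 1"
    and nll_data: "finite X_NLL" "\<forall>x\<in>X_NLL. 0 < w_NLL x" "(\<Sum>x\<in>X_NLL. w_NLL x) = 1"
    and be_data: "inj x_BE" "\<forall>j. 0 < w_BE j" "(\<Sum>j\<in>UNIV. w_BE j) = 1"
      "\<forall>j. finite (set_pmf (P j))"
    and zeta_data: "inj z_\<zeta>" "\<forall>g. 0 < w_\<zeta> g" "(\<Sum>g\<in>UNIV. w_\<zeta> g) = 1" "\<forall>g. N g \<noteq> {#}"
    and z_Q: "bij_betw z_Q UNIV (eval_pairs X_NLL x_BE P)"
    and ball_Q: "\<theta>\<^sub>0 \<in> B_Q" "\<theta>_iterates \<subseteq> B_Q"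
      "\<theta>_minimizers \<subseteq> minimizers R_hat" "\<theta>_minimizers \<subseteq> B_Q"
    and ball_zeta: "\<phi>\<^sub>0 \<in> B_\<zeta>" "\<phi>_iterates \<subseteq> B_\<zeta>"
      "\<phi>_minimizers \<subseteq> (\<Union>\<theta>\<^sub>2\<in>B_Q. minimizers (F_hat \<theta>\<^sub>2))" "\<phi>_minimizers \<subseteq> B_\<zeta>"
    and i: "C2_bounded_family B_Q (eval_pairs X_NLL x_BE P) Q"
      "C2_bounded_family B_\<zeta> (range z_\<zeta>) \<zeta>"
    and ii: "jacobian_conditioned B_Q z_Q Q"
    and iii: "jacobian_conditioned B_\<zeta> z_\<zeta> \<zeta>"
  shows "(\<exists>c>0. PL_inequality_on B_Q R_hat c) \<and>
    (\<forall>\<theta>\<^sub>2\<in>B_Q. \<exists>c>0. PL_inequality_on B_\<zeta> (F_hat \<theta>\<^sub>2) c)"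
proof (intro conjI ballI)
  \<comment> \<open>Compactness of the closed ball is what provides the uniform lower bound on the
    policy.\<close>
  have "compact B_Q"
    by (simp add: B_Q_def)
  then show "\<exists>c>0. PL_inequality_on B_Q R_hat c"
    unfolding R_hat_def
    by (intro nll_be_loss_PL[OF beta _ nll_data(1) _ be_data(1) _ _ z_Q _ ii])
      (use nll_data be_data i(1) in \<open>auto simp: C2_bounded_family_def\<close>)
next
  fix \<theta>\<^sub>2
  show "\<exists>c>0. PL_inequality_on B_\<zeta> (F_hat \<theta>\<^sub>2) c"
    unfolding F_hat_def
    by (intro aux_loss_PL[OF beta(1) _ _ iii])
      (use zeta_data i(2) in \<open>auto simp: C2_bounded_family_def\<close>)
qed

end
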